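(* Let $\mathcal{C}$ be a category and let $\Sigma$ be any family of arrows of $\mathcal{C}$. The following statements are equivalent: 1. There exists a congruence $R$ in $\mathcal{C}$ such that $Q_R:\mathcal{C}\to\mathcal{C}/R$ and $P_\Sigma:\mathcal{C}\to\mathcal{C}[\Sigma^{-1}]$ are isomorphic in the category $\mathcal{C}\downarrow\mathbb{C}at$ of categories under $\mathcal{C}$. 2. $P_\Sigma$ is a strict epimorphism, i.e. the induced functor $\mathcal{C}/\rho\Sigma\to\mathcal{C}[\Sigma^{-1}]$ is an isomorphism of categories. 3. $\Sigma\subseteq\sigma\rho\Sigma$.
   Context: $P_\Sigma:\mathcal{C}\to\mathcal{C}[\Sigma^{-1}]$ denotes the localization of $\mathcal{C}$ at $\Sigma$: it sends arrows of $\Sigma$ to isomorphisms, and every functor $F:\mathcal{C}\to\mathcal{D}$ sending arrows of $\Sigma$ to isomorphisms factors as $F=F'P_\Sigma$ for a unique functor $F'$ (size issues are ignored). A precongruence $R$ in $\mathcal{C}$ is a choice of a binary relation $R_{A,B}$ on $\mathcal{C}(A,B)$ for each pair of objects $A,B$. It is a congruence if each $R_{A,B}$ is an equivalence relation and $f\,R\,g$ implies $vfu\,R\,vgu$ whenever the compositions make sense. For a precongruence $R$, let $R'$ be the least congruence containing $R$; $\mathcal{C}/R$ is the category with the objects of $\mathcal{C}$ and with hom-sets $\mathcal{C}(A,B)/R'_{A,B}$, and $Q_R:\mathcal{C}\to\mathcal{C}/R$ is the quotient functor. For a family of arrows $\Sigma$, $\rho\Sigma$ is the congruence relating parallel arrows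 $f,g$ if and only if $P_\Sigma f=P_\Sigma g$. For a precongruence $R$, $\sigma R$ is the family of arrows sent to isomorphisms by $Q_R$, i.e. the arrows $f:X\to Y$ for which there is $g:Y\to X$ with $gf\,R'\,id_X$ and $fg\,R'\,id_Y$. An isomorphism in $\mathcal{C}\downarrow\mathbb{C}at$ is an isomorphism of categories commuting with the given functors from $\mathcal{C}$. The induced functor $\mathcal{C}/\rho\Sigma\to\mathcal{C}[\Sigma^{-1}]$ is the unique one whose composite with $Q_{\rho\Sigma}$ is $P_\Sigma$. *)

theory Defs
  imports Main "HOL-Library.FuncSet"
begin

section \<open>Categories and functors\<close>

text \<open>\<open>Comp C g f\<close> is the composite \<open>g \<circ> f\<close> (first \<open>f\<close>, then \<open>g\<close>). The operations are meaningful
  only on \<open>Ob C\<close>, \<open>Ar C\<close> and composable pairs; the values elsewhere are arbitrary.\<close>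

record ('o, 'a) cat =
  Ob :: "'o set"
  Ar :: "'a set"
  Dom :: "'a \<Rightarrow> 'o"
  Cod :: "'a \<Rightarrow> 'o"
  Id :: "'o \<Rightarrow> 'a"
  Comp :: "'a \<Rightarrow> 'a \<Rightarrow> 'a"

definition hom :: "('o, 'a) cat \<Rightarrow> 'o \<Rightarrow> 'o \<Rightarrow> 'a set" where
  "hom C A B = {f \<in> Ar C. Dom C f = A \<and> Cod C f = B}"

locale category =
  fixes C :: "('o, 'a) cat"
  assumes Dom_Ob: "f \<in> Ar C \<Longrightarrow> Dom C f \<in> Ob C"
    and Cod_Ob: "f \<in> Ar C \<Longrightarrow> Cod C f \<in> Ob C"
    and Id_hom: "A \<in> Ob C \<Longrightarrow> Id C A \<in> hom C A A"
    and Comp_hom: "f \<in> hom C A B \<Longrightarrow> g \<in> hom C B D \<Longrightarrow> Comp C g f \<in> hom C A D"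
    and Id_left: "f \<in> hom C A B \<Longrightarrow> Comp C (Id C B) f = f"
    and Id_right: "f \<in> hom C A B \<Longrightarrow> Comp C f (Id C A) = f"
    and Comp_assoc: "f \<in> hom C A B \<Longrightarrow> g \<in> hom C B D \<Longrightarrow> h \<in> hom C D E
      \<Longrightarrow> Comp C h (Comp C g f) = Comp C (Comp C h g) f"

definition iso_arr :: "('o, 'a) cat \<Rightarrow> 'a \<Rightarrow> bool" where
  "iso_arr C f \<longleftrightarrow> f \<in> Ar C \<and> (\<exists>g \<in> hom C (Cod C f) (Dom C f).
     Comp C g f = Id C (Dom C f) \<and> Comp C f g = Id C (Cod C f))"

record ('o, 'a, 'p, 'b) func =
  onOb :: "'o \<Rightarrow> 'p"
  onAr :: "'a \<Rightarrow> 'b"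

text \<open>Both components are \<open>undefined\<close> outside the source category, so that HOL equality of
  two functors with the same source is their equality as functors.\<close>

locale cat_functor = source: category C + target: category D
  for C :: "('o, 'a) cat" and D :: "('p, 'b) cat" +
  fixes F :: "('o, 'a, 'p, 'b) func"
  assumes onOb_type: "onOb F \<in> Ob C \<rightarrow>\<^sub>E Ob D"
    and onAr_ext: "onAr F \<in> extensional (Ar C)"
    and onAr_hom: "f \<in> hom C A B \<Longrightarrow> onAr F f \<in> hom D (onOb F A) (onOb F B)"
    and onAr_Id: "A \<in> Ob C \<Longrightarrow> onAr F (Id C A) = Id D (onOb F A)"
    and onAr_Comp: "f \<in> hom C A B \<Longrightarrow> g \<in> hom C B E
      \<Longrightarrow> onAr F (Comp C g f) = Comp D (onAr F g) (onAr F f)"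

definition func_id :: "('o, 'a) cat \<Rightarrow> ('o, 'a, 'o, 'a) func" where
  "func_id C = \<lparr>onOb = (\<lambda>A \<in> Ob C. A), onAr = (\<lambda>f \<in> Ar C. f)\<rparr>"

text \<open>\<open>func_comp C G F\<close> is \<open>G \<circ> F\<close>, where \<open>C\<close> is the source of \<open>F\<close>.\<close>

definition func_comp ::
  "('o, 'a) cat \<Rightarrow> ('p, 'b, 'q, 'c) func \<Rightarrow> ('o, 'a, 'p, 'b) func \<Rightarrow> ('o, 'a, 'q, 'c) func" where
  "func_comp C G F =
     \<lparr>onOb = compose (Ob C) (onOb G) (onOb F), onAr = compose (Ar C) (onAr G) (onAr F)\<rparr>"

definition cat_iso :: "('o, 'a) cat \<Rightarrow> ('p, 'b) cat \<Rightarrow> ('o, 'a, 'p, 'b) func \<Rightarrow> bool" where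
  "cat_iso C D F \<longleftrightarrow> cat_functor C D F \<and>
     (\<exists>G. cat_functor D C G \<and> func_comp C G F = func_id C \<and> func_comp D F G = func_id D)"

definition iso_under :: "('o, 'a) cat \<Rightarrow> ('p, 'b) cat \<Rightarrow> ('o, 'a, 'p, 'b) func
    \<Rightarrow> ('q, 'c) cat \<Rightarrow> ('o, 'a, 'q, 'c) func \<Rightarrow> bool" where
  "iso_under C D F E G \<longleftrightarrow> cat_functor C D F \<and> cat_functor C E G \<and>
     (\<exists>H. cat_iso D E H \<and> func_comp C H F = G)"


section \<open>Precongruences and quotient categories\<close>

type_synonym ('o, 'a) hom_rel = "'o \<Rightarrow> 'o \<Rightarrow> 'a rel"

definition precongruence :: "('o, 'a) cat \<Rightarrow> ('o, 'a) hom_rel \<Rightarrow> bool" where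
  "precongruence C R \<longleftrightarrow> (\<forall>A B. R A B \<subseteq> hom C A B \<times> hom C A B)"

definition congruence :: "('o, 'a) cat \<Rightarrow> ('o, 'a) hom_rel \<Rightarrow> bool" where
  "congruence C R \<longleftrightarrow> precongruence C R \<and>
     (\<forall>A B. equiv (hom C A B) (R A B)) \<and>
     (\<forall>A' A B B' u f g v. u \<in> hom C A' A \<longrightarrow> (f, g) \<in> R A B \<longrightarrow> v \<in> hom C B B'
        \<longrightarrow> (Comp C v (Comp C f u), Comp C v (Comp C g u)) \<in> R A' B')"

definition cong_cl :: "('o, 'a) cat \<Rightarrow> ('o, 'a) hom_rel \<Rightarrow> ('o, 'a) hom_rel" where
  "cong_cl C R A B = \<Inter> {S A B | S. congruence C S \<and> (\<forall>A B. R A B \<subseteq> S A B)}"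

definition qcls :: "('o, 'a) cat \<Rightarrow> ('o, 'a) hom_rel \<Rightarrow> 'a \<Rightarrow> 'a set" where
  "qcls C R f = cong_cl C R (Dom C f) (Cod C f) `` {f}"

text \<open>Congruence classes are nonempty subsets of a single hom-set, so distinct hom-sets of the
  quotient are disjoint, and source and target of a class may be read off any representative.\<close>

definition quot :: "('o, 'a) cat \<Rightarrow> ('o, 'a) hom_rel \<Rightarrow> ('o, 'a set) cat" where
  "quot C R = \<lparr>Ob = Ob C,
     Ar = (\<Union>A \<in> Ob C. \<Union>B \<in> Ob C. hom C A B // cong_cl C R A B),
     Dom = (\<lambda>X. Dom C (SOME f. f \<in> X)),
     Cod = (\<lambda>X. Cod C (SOME f. f \<in> X)),
     Id = (\<lambda>A. qcls C R (Id C A)),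
     Comp = (\<lambda>Y X. qcls C R (Comp C (SOME g. g \<in> Y) (SOME f. f \<in> X)))\<rparr>"

definition quot_fun :: "('o, 'a) cat \<Rightarrow> ('o, 'a) hom_rel \<Rightarrow> ('o, 'a, 'o, 'a set) func" where
  "quot_fun C R = \<lparr>onOb = (\<lambda>A \<in> Ob C. A), onAr = (\<lambda>f \<in> Ar C. qcls C R f)\<rparr>"


section \<open>Localization\<close>

text \<open>The localization of \<open>C\<close> at \<open>\<Sigma>\<close> is the category of zigzags of arrows of \<open>C\<close> and formally
  reversed arrows of \<open>\<Sigma>\<close>, modulo the evident relations. Its universal property, with respect
  to categories over arbitrary types, is theorem \<open>loc_universal\<close> below.\<close>

datatype 'a step = Fwd 'a | Bwd 'a

fun zpath :: "('o, 'a) cat \<Rightarrow> 'a set \<Rightarrow> 'o \<Rightarrow> 'a step list \<Rightarrow> 'o \<Rightarrow> bool" where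
  "zpath C \<Sigma> A [] B \<longleftrightarrow> A \<in> Ob C \<and> A = B"
| "zpath C \<Sigma> A (Fwd f # w) B \<longleftrightarrow> f \<in> Ar C \<and> Dom C f = A \<and> zpath C \<Sigma> (Cod C f) w B"
| "zpath C \<Sigma> A (Bwd s # w) B \<longleftrightarrow> s \<in> \<Sigma> \<and> Cod C s = A \<and> zpath C \<Sigma> (Dom C s) w B"

definition zigzag :: "('o, 'a) cat \<Rightarrow> 'a set \<Rightarrow> ('o, 'o \<times> 'a step list \<times> 'o) cat" where
  "zigzag C \<Sigma> = \<lparr>Ob = Ob C,
     Ar = {(A, w, B) | A w B. zpath C \<Sigma> A w B},
     Dom = (\<lambda>(A, w, B). A),
     Cod = (\<lambda>(A, w, B). B),
     Id = (\<lambda>A. (A, [], A)),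
     Comp = (\<lambda>(_, v, D) (A, w, _). (A, w @ v, D))\<rparr>"

inductive_set zz_gen ::
  "('o, 'a) cat \<Rightarrow> 'a set \<Rightarrow> ('o \<times> 'a step list \<times> 'o) rel"
  for C :: "('o, 'a) cat" and \<Sigma> :: "'a set" where
  zz_Id: "A \<in> Ob C \<Longrightarrow> ((A, [Fwd (Id C A)], A), (A, [], A)) \<in> zz_gen C \<Sigma>"
| zz_Comp: "f \<in> hom C A B \<Longrightarrow> g \<in> hom C B D
    \<Longrightarrow> ((A, [Fwd f, Fwd g], D), (A, [Fwd (Comp C g f)], D)) \<in> zz_gen C \<Sigma>"
| zz_inv_left: "s \<in> \<Sigma> \<Longrightarrow> s \<in> hom C A B
    \<Longrightarrow> ((A, [Fwd s, Bwd s], A), (A, [], A)) \<in> zz_gen C \<Sigma>"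
| zz_inv_right: "s \<in> \<Sigma> \<Longrightarrow> s \<in> hom C A B
    \<Longrightarrow> ((B, [Bwd s, Fwd s], B), (B, [], B)) \<in> zz_gen C \<Sigma>"

definition zz_rel :: "('o, 'a) cat \<Rightarrow> 'a set \<Rightarrow> ('o, 'o \<times> 'a step list \<times> 'o) hom_rel" where
  "zz_rel C \<Sigma> A B = zz_gen C \<Sigma> \<inter> (hom (zigzag C \<Sigma>) A B \<times> hom (zigzag C \<Sigma>) A B)"

definition loc :: "('o, 'a) cat \<Rightarrow> 'a set \<Rightarrow> ('o, ('o \<times> 'a step list \<times> 'o) set) cat" where
  "loc C \<Sigma> = quot (zigzag C \<Sigma>) (zz_rel C \<Sigma>)"

definition loc_fun ::
  "('o, 'a) cat \<Rightarrow> 'a set \<Rightarrow> ('o, 'a, 'o, ('o \<times> 'a step list \<times> 'o) set) func" where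
  "loc_fun C \<Sigma> = \<lparr>onOb = (\<lambda>A \<in> Ob C. A),
     onAr = (\<lambda>f \<in> Ar C. onAr (quot_fun (zigzag C \<Sigma>) (zz_rel C \<Sigma>)) (Dom C f, [Fwd f], Cod C f))\<rparr>"


section \<open>The correspondences between families of arrows and precongruences\<close>

definition rho :: "('o, 'a) cat \<Rightarrow> 'a set \<Rightarrow> ('o, 'a) hom_rel" where
  "rho C \<Sigma> A B = {(f, g). f \<in> hom C A B \<and> g \<in> hom C A B
     \<and> onAr (loc_fun C \<Sigma>) f = onAr (loc_fun C \<Sigma>) g}"

definition sigma :: "('o, 'a) cat \<Rightarrow> ('o, 'a) hom_rel \<Rightarrow> 'a set" where
  "sigma C R = {f \<in> Ar C. iso_arr (quot C R) (onAr (quot_fun C R) f)}"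

text \<open>Existence and uniqueness of the functor described here is theorem
  \<open>induced_fun_ex1\<close> below.\<close>

definition induced_fun ::
  "('o, 'a) cat \<Rightarrow> 'a set \<Rightarrow> ('o, 'a set, 'o, ('o \<times> 'a step list \<times> 'o) set) func" where
  "induced_fun C \<Sigma> = (THE I. cat_functor (quot C (rho C \<Sigma>)) (loc C \<Sigma>) I
     \<and> func_comp C I (quot_fun C (rho C \<Sigma>)) = loc_fun C \<Sigma>)"

text \<open>Being a strict epimorphism is taken for \<open>loc_fun C \<Sigma>\<close> in the form: the comparison functor
  out of the quotient by its kernel congruence is an isomorphism of categories.\<close>

definition strict_epi_loc :: "('o, 'a) cat \<Rightarrow> 'a set \<Rightarrow> bool" where
  "strict_epi_loc C \<Sigma> \<longleftrightarrow> cat_iso (quot C (rho C \<Sigma>)) (loc C \<Sigma>) (induced_fun C \<Sigma>)"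


section \<open>Basic properties of the constructions\<close>

lemma homI: "f \<in> Ar C \<Longrightarrow> Dom C f = A \<Longrightarrow> Cod C f = B \<Longrightarrow> f \<in> hom C A B"
  by (simp add: hom_def)

lemma homD: "f \<in> hom C A B \<Longrightarrow> f \<in> Ar C \<and> Dom C f = A \<and> Cod C f = B"
  by (simp add: hom_def)

lemma (in category) hom_Ob: "f \<in> hom C A B \<Longrightarrow> A \<in> Ob C \<and> B \<in> Ob C"
  using Dom_Ob Cod_Ob by (auto simp: hom_def)

lemma func_eqI:
  assumes "cat_functor C D F" "cat_functor C D G"
    and "\<And>A. A \<in> Ob C \<Longrightarrow> onOb F A = onOb G A"
    and "\<And>f. f \<in> Ar C \<Longrightarrow> onAr F f = onAr G f"
  shows "F = G"
proof -
  interpret F: cat_functor C D F by fact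
  interpret G: cat_functor C D G by fact
  have "onOb F = onOb G"
    using F.onOb_type G.onOb_type assms(3)
    by (intro extensionalityI[of _ "Ob C"]) (auto simp: PiE_def)
  moreover have "onAr F = onAr G"
    using F.onAr_ext G.onAr_ext assms(4) by (intro extensionalityI[of _ "Ar C"]) auto
  ultimately show ?thesis by simp
qed

lemma (in cat_functor) onOb_in: "A \<in> Ob C \<Longrightarrow> onOb F A \<in> Ob D"
  using onOb_type by auto

lemma func_comp_functor:
  assumes "cat_functor C D F" "cat_functor D E G"
  shows "cat_functor C E (func_comp C G F)"
proof -
  interpret F: cat_functor C D F by fact
  interpret G: cat_functor D E G by fact
  show ?thesis
  proof
    show "onOb (func_comp C G F) \<in> Ob C \<rightarrow>\<^sub>E Ob E"
      using F.onOb_type G.onOb_type by (auto simp: func_comp_def compose_def)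
    show "onAr (func_comp C G F) \<in> extensional (Ar C)"
      by (simp add: func_comp_def compose_def)
  next
    fix f A B assume f: "f \<in> hom C A B"
    have "A \<in> Ob C" "B \<in> Ob C" "f \<in> Ar C"
      using F.source.hom_Ob[OF f] homD[OF f] by auto
    then show "onAr (func_comp C G F) f
        \<in> hom E (onOb (func_comp C G F) A) (onOb (func_comp C G F) B)"
      using G.onAr_hom[OF F.onAr_hom[OF f]] by (simp add: func_comp_def compose_def)
  next
    fix A assume A: "A \<in> Ob C"
    then have "Id C A \<in> Ar C" using F.source.Id_hom homD by metis
    then show "onAr (func_comp C G F) (Id C A) = Id E (onOb (func_comp C G F) A)"
      using A F.onAr_Id[OF A] G.onAr_Id[OF F.onOb_in[OF A]]
      by (simp add: func_comp_def compose_def)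
  next
    fix f A B g E'
    assume f: "f \<in> hom C A B" and g: "g \<in> hom C B E'"
    then have "f \<in> Ar C" "g \<in> Ar C" "Comp C g f \<in> Ar C"
      using F.source.Comp_hom homD by metis+
    then show "onAr (func_comp C G F) (Comp C g f)
        = Comp E (onAr (func_comp C G F) g) (onAr (func_comp C G F) f)"
      using F.onAr_Comp[OF f g] G.onAr_Comp[OF F.onAr_hom[OF f] F.onAr_hom[OF g]]
      by (simp add: func_comp_def compose_def)
  qed
qed

lemma full_congruence: "category C \<Longrightarrow> congruence C (\<lambda>A B. hom C A B \<times> hom C A B)"
  unfolding congruence_def precongruence_def
  by (auto intro: category.Comp_hom equivI refl_onI symI transI)

lemma cong_cl_iff:
  "(f, g) \<in> cong_cl C R A B \<longleftrightarrow>
     (\<forall>S. congruence C S \<longrightarrow> (\<forall>A B. R A B \<subseteq> S A B) \<longrightarrow> (f, g) \<in> S A B)"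
  unfolding cong_cl_def by blast

lemma cong_cl_least:
  "congruence C S \<Longrightarrow> (\<And>A B. R A B \<subseteq> S A B) \<Longrightarrow> cong_cl C R A B \<subseteq> S A B"
  unfolding cong_cl_def by blast

lemma cong_cl_upper: "R A B \<subseteq> cong_cl C R A B"
  unfolding cong_cl_def by blast

lemma cong_cl_congruence:
  assumes "category C" "precongruence C R"
  shows "congruence C (cong_cl C R)"
proof -
  have sub: "cong_cl C R A B \<subseteq> hom C A B \<times> hom C A B" for A B
    by (rule cong_cl_least[OF full_congruence[OF assms(1)]])
       (use assms(2) in \<open>simp add: precongruence_def\<close>)
  have eqv: "equiv (hom C A B) (cong_cl C R A B)" for A B
  proof (rule equivI)
    show "cong_cl C R A B \<subseteq> hom C A B \<times> hom C A B" by (rule sub)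
    show "refl_on (hom C A B) (cong_cl C R A B)"
      by (auto simp: refl_on_def cong_cl_iff congruence_def equiv_def)
    show "sym (cong_cl C R A B)"
      unfolding sym_def cong_cl_iff congruence_def equiv_def by blast
    show "trans (cong_cl C R A B)"
      unfolding trans_def cong_cl_iff congruence_def equiv_def by blast
  qed
  show ?thesis
    unfolding congruence_def precongruence_def
  proof (intro conjI allI impI)
    fix A' A B B' u f g v
    assume "u \<in> hom C A' A" "(f, g) \<in> cong_cl C R A B" "v \<in> hom C B B'"
    then show "(Comp C v (Comp C f u), Comp C v (Comp C g u)) \<in> cong_cl C R A' B'"
      unfolding cong_cl_iff congruence_def by blast
  qed (use sub eqv in auto)
qed

lemma cong_cl_id: "congruence C R \<Longrightarrow> cong_cl C R = R"
  by (intro ext equalityI cong_cl_least cong_cl_upper) auto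

locale quotient_cat = category C for C :: "('o, 'a) cat" +
  fixes R :: "('o, 'a) hom_rel"
  assumes precong: "precongruence C R"
begin

lemma cong: "congruence C (cong_cl C R)"
  using cong_cl_congruence precong category_axioms by blast

lemma eqv: "equiv (hom C A B) (cong_cl C R A B)"
  using cong unfolding congruence_def by blast

lemma cong_Comp:
  assumes "(f, f') \<in> cong_cl C R A B" "(g, g') \<in> cong_cl C R B D"
  shows "(Comp C g f, Comp C g' f') \<in> cong_cl C R A D"
proof -
  have c: "\<And>A' A B B' u f g v. u \<in> hom C A' A \<Longrightarrow> (f, g) \<in> cong_cl C R A B \<Longrightarrow> v \<in> hom C B B'
      \<Longrightarrow> (Comp C v (Comp C f u), Comp C v (Comp C g u)) \<in> cong_cl C R A' B'"
    using cong unfolding congruence_def by blast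
  have h: "f \<in> hom C A B" "f' \<in> hom C A B" "g \<in> hom C B D" "g' \<in> hom C B D"
    using assms eqv equiv_type by blast+
  have Ob: "A \<in> Ob C" "B \<in> Ob C" "D \<in> Ob C" using h hom_Ob by blast+
  have "(Comp C g (Comp C f (Id C A)), Comp C g (Comp C f' (Id C A))) \<in> cong_cl C R A D"
    using c[OF Id_hom[OF Ob(1)] assms(1) h(3)] .
  then have 1: "(Comp C g f, Comp C g f') \<in> cong_cl C R A D"
    using h by (simp add: Id_right[of _ A B])
  have "(Comp C (Id C D) (Comp C g f'), Comp C (Id C D) (Comp C g' f')) \<in> cong_cl C R A D"
    using c[OF h(2) assms(2) Id_hom[OF Ob(3)]] .
  then have 2: "(Comp C g f', Comp C g' f') \<in> cong_cl C R A D"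
    using h by (simp add: Id_left[OF Comp_hom[OF h(2)]])
  show ?thesis using 1 2 eqv[of A D] unfolding equiv_def trans_def by blast
qed

lemma qcls_self: "f \<in> hom C A B \<Longrightarrow> f \<in> qcls C R f"
  using equiv_class_self[OF eqv[of A B], of f] homD[of f C A B] by (simp add: qcls_def)

lemma qcls_quotient: "f \<in> hom C A B \<Longrightarrow> qcls C R f \<in> hom C A B // cong_cl C R A B"
  unfolding qcls_def by (auto intro!: quotientI simp: hom_def)

lemma qcls_eq_iff:
  assumes "f \<in> hom C A B" "g \<in> hom C A B"
  shows "qcls C R f = qcls C R g \<longleftrightarrow> (f, g) \<in> cong_cl C R A B"
  using eq_equiv_class_iff[OF eqv[of A B] assms] homD[OF assms(1)] homD[OF assms(2)]
  unfolding qcls_def by auto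

lemma qcls_some:
  assumes "f \<in> hom C A B"
  shows "(f, SOME g. g \<in> qcls C R f) \<in> cong_cl C R A B" "(SOME g. g \<in> qcls C R f) \<in> hom C A B"
proof -
  have "(SOME g. g \<in> qcls C R f) \<in> qcls C R f"
    using qcls_self[OF assms] by (rule someI)
  then show 1: "(f, SOME g. g \<in> qcls C R f) \<in> cong_cl C R A B"
    using homD[OF assms] unfolding qcls_def by auto
  show "(SOME g. g \<in> qcls C R f) \<in> hom C A B"
    using equiv_type[OF eqv] 1 by blast
qed

lemma qcls_hom:
  assumes "f \<in> hom C A B"
  shows "qcls C R f \<in> hom (quot C R) A B"
  using qcls_some(2)[OF assms] qcls_quotient[OF assms] hom_Ob[OF assms]
  by (auto simp: hom_def quot_def)

lemma quot_homE:
  assumes "X \<in> hom (quot C R) A B"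
  obtains f where "f \<in> hom C A B" "X = qcls C R f"
proof -
  obtain A' B' where "X \<in> hom C A' B' // cong_cl C R A' B'"
    using assms by (auto simp: hom_def quot_def)
  then obtain f where f: "f \<in> hom C A' B'" "X = cong_cl C R A' B' `` {f}"
    by (auto elim: quotientE)
  then have X: "X = qcls C R f" using homD[OF f(1)] by (simp add: qcls_def)
  then have "A' = A" "B' = B" using homD[OF qcls_hom[OF f(1)]] homD[OF assms] by auto
  then show ?thesis using that f(1) X by blast
qed

lemma Comp_quot:
  assumes "f \<in> hom C A B" "g \<in> hom C B D"
  shows "Comp (quot C R) (qcls C R g) (qcls C R f) = qcls C R (Comp C g f)"
proof -
  note f = qcls_some[OF assms(1)] and g = qcls_some[OF assms(2)]
  have "(Comp C g f, Comp C (SOME x. x \<in> qcls C R g) (SOME x. x \<in> qcls C R f))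
      \<in> cong_cl C R A D"
    using cong_Comp f(1) g(1) by blast
  then show ?thesis
    using qcls_eq_iff[OF Comp_hom[OF assms] Comp_hom[OF f(2) g(2)]] by (simp add: quot_def)
qed

lemma Id_quot: "Id (quot C R) A = qcls C R (Id C A)"
  and Ob_quot: "Ob (quot C R) = Ob C"
  by (simp_all add: quot_def)

lemma quot_ArE:
  assumes "X \<in> Ar (quot C R)"
  obtains A B f where "X \<in> hom (quot C R) A B" "f \<in> hom C A B" "X = qcls C R f"
  using assms quot_homE[of X "Dom (quot C R) X" "Cod (quot C R) X"] homI by metis

theorem quot_category: "category (quot C R)"
proof
  fix X assume "X \<in> Ar (quot C R)"
  then obtain A B f where "X \<in> hom (quot C R) A B" "f \<in> hom C A B" by (elim quot_ArE)
  then show "Dom (quot C R) X \<in> Ob (quot C R)" "Cod (quot C R) X \<in> Ob (quot C R)"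
    using hom_Ob homD Ob_quot by metis+
next
  fix A assume "A \<in> Ob (quot C R)"
  then show "Id (quot C R) A \<in> hom (quot C R) A A"
    using qcls_hom Id_hom by (simp add: Id_quot Ob_quot)
next
  fix X A B Y D assume "X \<in> hom (quot C R) A B" "Y \<in> hom (quot C R) B D"
  then show "Comp (quot C R) Y X \<in> hom (quot C R) A D"
    by (elim quot_homE) (simp add: Comp_quot qcls_hom Comp_hom)
next
  fix X A B assume X: "X \<in> hom (quot C R) A B"
  then obtain f where f: "f \<in> hom C A B" "X = qcls C R f" by (rule quot_homE)
  show "Comp (quot C R) (Id (quot C R) B) X = X" "Comp (quot C R) X (Id (quot C R) A) = X"
    using f Comp_quot[OF f(1) Id_hom] Comp_quot[OF Id_hom f(1)] hom_Ob[OF f(1)]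
    by (simp_all add: Id_quot Id_left[OF f(1)] Id_right[OF f(1)])
next
  fix X A B Y D Z E
  assume "X \<in> hom (quot C R) A B" "Y \<in> hom (quot C R) B D" "Z \<in> hom (quot C R) D E"
  then obtain f g h where fgh: "f \<in> hom C A B" "X = qcls C R f" "g \<in> hom C B D" "Y = qcls C R g"
    "h \<in> hom C D E" "Z = qcls C R h"
    by (elim quot_homE)
  then show "Comp (quot C R) Z (Comp (quot C R) Y X) = Comp (quot C R) (Comp (quot C R) Z Y) X"
    by (simp add: Comp_quot[OF fgh(1) fgh(3)] Comp_quot[OF fgh(3) fgh(5)]
        Comp_quot[OF Comp_hom[OF fgh(1) fgh(3)] fgh(5)]
        Comp_quot[OF fgh(1) Comp_hom[OF fgh(3) fgh(5)]] Comp_assoc[OF fgh(1) fgh(3) fgh(5)])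
qed

lemma quot_fun_Ob: "A \<in> Ob C \<Longrightarrow> onOb (quot_fun C R) A = A"
  by (simp add: quot_fun_def)

lemma quot_fun_Ar: "f \<in> hom C A B \<Longrightarrow> onAr (quot_fun C R) f = qcls C R f"
  by (simp add: quot_fun_def hom_def)

theorem quot_fun_functor: "cat_functor C (quot C R) (quot_fun C R)"
proof (intro cat_functor.intro cat_functor_axioms.intro category_axioms quot_category)
  show "onOb (quot_fun C R) \<in> Ob C \<rightarrow>\<^sub>E Ob (quot C R)"
    by (auto simp: quot_fun_def Ob_quot)
  show "onAr (quot_fun C R) \<in> extensional (Ar C)"
    by (simp add: quot_fun_def)
next
  fix f A B assume f: "f \<in> hom C A B"
  then show "onAr (quot_fun C R) f
      \<in> hom (quot C R) (onOb (quot_fun C R) A) (onOb (quot_fun C R) B)"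
    using hom_Ob[OF f] by (simp add: quot_fun_Ob quot_fun_Ar[OF f] qcls_hom)
next
  fix A assume A: "A \<in> Ob C"
  then show "onAr (quot_fun C R) (Id C A) = Id (quot C R) (onOb (quot_fun C R) A)"
    using Id_hom[OF A] by (simp add: quot_fun_Ob quot_fun_Ar[of _ A A] Id_quot)
next
  fix f A B g E assume f: "f \<in> hom C A B" "g \<in> hom C B E"
  then show "onAr (quot_fun C R) (Comp C g f)
      = Comp (quot C R) (onAr (quot_fun C R) g) (onAr (quot_fun C R) f)"
    by (simp add: quot_fun_Ar[OF f(1)] quot_fun_Ar[OF f(2)] quot_fun_Ar[OF Comp_hom[OF f]]
        Comp_quot[OF f])
qed

lemma kernel_congruence:
  assumes "cat_functor C D F"
  shows "congruence C (\<lambda>A B. {(f, g). f \<in> hom C A B \<and> g \<in> hom C A B \<and> onAr F f = onAr F g})"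
proof -
  interpret F: cat_functor C D F by fact
  show ?thesis
    unfolding congruence_def precongruence_def
  proof (intro conjI allI impI)
    fix A' A B B' u f g v
    assume u: "u \<in> hom C A' A" and v: "v \<in> hom C B B'"
      and fg: "(f, g) \<in> {(f, g). f \<in> hom C A B \<and> g \<in> hom C A B \<and> onAr F f = onAr F g}"
    then have f: "f \<in> hom C A B" and g: "g \<in> hom C A B" and e: "onAr F f = onAr F g" by auto
    have "onAr F (Comp C v (Comp C f u)) = onAr F (Comp C v (Comp C g u))"
      using F.onAr_Comp[OF Comp_hom[OF u f] v] F.onAr_Comp[OF Comp_hom[OF u g] v]
        F.onAr_Comp[OF u f] F.onAr_Comp[OF u g] e by simp
    then show "(Comp C v (Comp C f u), Comp C v (Comp C g u))
        \<in> {(f, g). f \<in> hom C A' B' \<and> g \<in> hom C A' B' \<and> onAr F f = onAr F g}"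
      using Comp_hom[OF Comp_hom[OF u f] v] Comp_hom[OF Comp_hom[OF u g] v] by auto
  qed (auto intro!: equivI refl_onI symI transI)
qed

theorem quot_universal:
  assumes "cat_functor C D F"
    and R: "\<And>A B f g. (f, g) \<in> R A B \<Longrightarrow> onAr F f = onAr F g"
  shows "\<exists>!G. cat_functor (quot C R) D G \<and> func_comp C G (quot_fun C R) = F"
proof -
  interpret F: cat_functor C D F by fact
  interpret Q: category "quot C R" by (rule quot_category)
  have ker: "onAr F f = onAr F g" if "(f, g) \<in> cong_cl C R A B" for f g A B
    using cong_cl_least[OF kernel_congruence[OF assms(1)], of R A B] R precong that
    unfolding precongruence_def by blast
  define G where "G = \<lparr>onOb = onOb F, onAr = (\<lambda>X \<in> Ar (quot C R). onAr F (SOME f. f \<in> X))\<rparr>"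
  have G_q: "onAr G (qcls C R f) = onAr F f" if "f \<in> hom C A B" for f A B
    using qcls_hom[OF that] ker[OF qcls_some(1)[OF that]] by (simp add: G_def hom_def)
  have G: "cat_functor (quot C R) D G"
  proof (intro cat_functor.intro cat_functor_axioms.intro quot_category F.target.category_axioms)
    show "onOb G \<in> Ob (quot C R) \<rightarrow>\<^sub>E Ob D" using F.onOb_type by (simp add: G_def Ob_quot)
    show "onAr G \<in> extensional (Ar (quot C R))" by (simp add: G_def)
  next
    fix X A B assume "X \<in> hom (quot C R) A B"
    then obtain f where f: "f \<in> hom C A B" "X = qcls C R f" by (rule quot_homE)
    then show "onAr G X \<in> hom D (onOb G A) (onOb G B)"
      using F.onAr_hom[OF f(1)] G_q[OF f(1)] by (simp add: G_def)
  next
    fix A assume A: "A \<in> Ob (quot C R)"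
    then show "onAr G (Id (quot C R) A) = Id D (onOb G A)"
      using F.onAr_Id[of A] G_q[OF Id_hom[of A]] by (simp add: Id_quot Ob_quot G_def)
  next
    fix X A B Y E assume "X \<in> hom (quot C R) A B" "Y \<in> hom (quot C R) B E"
    then obtain f g where fg: "f \<in> hom C A B" "X = qcls C R f" "g \<in> hom C B E" "Y = qcls C R g"
      by (elim quot_homE)
    then show "onAr G (Comp (quot C R) Y X) = Comp D (onAr G Y) (onAr G X)"
      using F.onAr_Comp[OF fg(1) fg(3)]
      by (simp add: Comp_quot[OF fg(1) fg(3)] G_q[OF fg(1)] G_q[OF fg(3)]
          G_q[OF Comp_hom[OF fg(1) fg(3)]])
  qed
  have GQ: "func_comp C G (quot_fun C R) = F"
  proof (rule func_eqI[OF func_comp_functor[OF quot_fun_functor G] assms(1)])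
    fix A assume "A \<in> Ob C"
    then show "onOb (func_comp C G (quot_fun C R)) A = onOb F A"
      by (simp add: func_comp_def compose_def quot_fun_Ob G_def)
  next
    fix f assume f: "f \<in> Ar C"
    then have "f \<in> hom C (Dom C f) (Cod C f)" by (simp add: hom_def)
    then show "onAr (func_comp C G (quot_fun C R)) f = onAr F f"
      using f by (simp add: func_comp_def compose_def quot_fun_Ar G_q)
  qed
  show ?thesis
  proof (rule ex1I, rule conjI[OF G GQ])
    fix H assume H: "cat_functor (quot C R) D H \<and> func_comp C H (quot_fun C R) = F"
    show "H = G"
    proof (rule func_eqI[OF _ G])
      show "cat_functor (quot C R) D H" using H by blast
    next
      fix A assume "A \<in> Ob (quot C R)"
      then have A: "A \<in> Ob C" by (simp add: Ob_quot)
      have "onOb (func_comp C H (quot_fun C R)) A = onOb (func_comp C G (quot_fun C R)) A"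
        using H GQ by simp
      then show "onOb H A = onOb G A"
        using A by (simp add: func_comp_def compose_def quot_fun_Ob)
    next
      fix X assume "X \<in> Ar (quot C R)"
      then obtain A B f where f: "f \<in> hom C A B" "X = qcls C R f" by (elim quot_ArE)
      have "onAr (func_comp C H (quot_fun C R)) f = onAr (func_comp C G (quot_fun C R)) f"
        using H GQ by simp
      then show "onAr H X = onAr G X"
        using f homD[OF f(1)] by (simp add: func_comp_def compose_def quot_fun_Ar[OF f(1)])
    qed
  qed
qed

lemma sigma_iff:
  "f \<in> sigma C R \<longleftrightarrow> f \<in> Ar C \<and> (\<exists>g \<in> hom C (Cod C f) (Dom C f).
     (Comp C g f, Id C (Dom C f)) \<in> cong_cl C R (Dom C f) (Dom C f) \<and>
     (Comp C f g, Id C (Cod C f)) \<in> cong_cl C R (Cod C f) (Cod C f))"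
proof (cases "f \<in> Ar C")
  case True
  let ?X = "Dom C f" and ?Y = "Cod C f"
  have f: "f \<in> hom C ?X ?Y" using True by (simp add: hom_def)
  have Ob: "?X \<in> Ob C" "?Y \<in> Ob C" using hom_Ob[OF f] by auto
  note q = homD[OF qcls_hom[OF f]]
  have eq: "Comp (quot C R) (qcls C R g) (qcls C R f) = Id (quot C R) ?X
       \<longleftrightarrow> (Comp C g f, Id C ?X) \<in> cong_cl C R ?X ?X"
     "Comp (quot C R) (qcls C R f) (qcls C R g) = Id (quot C R) ?Y
       \<longleftrightarrow> (Comp C f g, Id C ?Y) \<in> cong_cl C R ?Y ?Y" if g: "g \<in> hom C ?Y ?X" for g
    using qcls_eq_iff[OF Comp_hom[OF f g] Id_hom[OF Ob(1)]]
      qcls_eq_iff[OF Comp_hom[OF g f] Id_hom[OF Ob(2)]]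
    by (simp_all add: Comp_quot[OF f g] Comp_quot[OF g f] Id_quot)
  have "iso_arr (quot C R) (qcls C R f) \<longleftrightarrow> (\<exists>g \<in> hom C ?Y ?X.
      Comp (quot C R) (qcls C R g) (qcls C R f) = Id (quot C R) ?X \<and>
      Comp (quot C R) (qcls C R f) (qcls C R g) = Id (quot C R) ?Y)"
    using q by (auto simp: iso_arr_def elim!: quot_homE intro: bexI[OF _ qcls_hom])
  then show ?thesis
    using True eq by (auto simp: sigma_def quot_fun_Ar[OF f])
qed (simp add: sigma_def)

end

lemma is_inverse_unique:
  assumes "category C" "f \<in> hom C A B" "g \<in> hom C B A" "h \<in> hom C B A"
    and "Comp C g f = Id C A" "Comp C f h = Id C B"
  shows "g = h"
proof -
  interpret category C by fact
  have "g = Comp C g (Comp C f h)" using assms Id_right[OF assms(3)] by simp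
  also have "\<dots> = h"
    using assms Comp_assoc[OF assms(4,2,3)] Id_left[OF assms(4)] by simp
  finally show ?thesis .
qed

lemma functor_iso_arr:
  assumes "cat_functor C D F" "iso_arr C f"
  shows "iso_arr D (onAr F f)"
proof -
  interpret F: cat_functor C D F by fact
  let ?X = "Dom C f" and ?Y = "Cod C f"
  obtain g where f: "f \<in> hom C ?X ?Y" and g: "g \<in> hom C ?Y ?X"
    and e: "Comp C g f = Id C ?X" "Comp C f g = Id C ?Y"
    using assms(2) by (auto simp: iso_arr_def hom_def)
  have "Comp D (onAr F g) (onAr F f) = Id D (onOb F ?X)"
    "Comp D (onAr F f) (onAr F g) = Id D (onOb F ?Y)"
    using F.onAr_Comp[OF f g] F.onAr_Comp[OF g f] e F.source.hom_Ob[OF f] F.onAr_Id by auto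
  then show ?thesis
    using homD[OF F.onAr_hom[OF f]] F.onAr_hom[OF g] by (auto simp: iso_arr_def)
qed

lemma zpath_Ob:
  assumes "category C" "\<Sigma> \<subseteq> Ar C"
  shows "zpath C \<Sigma> A w B \<Longrightarrow> A \<in> Ob C \<and> B \<in> Ob C"
proof (induction w arbitrary: A)
  case (Cons x w)
  then show ?case
    using category.Dom_Ob[OF assms(1)] category.Cod_Ob[OF assms(1)] assms(2)
    by (cases x) auto
qed auto

lemma zpath_append: "zpath C \<Sigma> A w B \<Longrightarrow> zpath C \<Sigma> B v D \<Longrightarrow> zpath C \<Sigma> A (w @ v) D"
  by (induction C \<Sigma> A w B rule: zpath.induct) auto

lemma zigzag_hom: "hom (zigzag C \<Sigma>) A B = {(A, w, B) | w. zpath C \<Sigma> A w B}"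
  by (auto simp: hom_def zigzag_def)

locale localized_cat = category C for C :: "('o, 'a) cat" +
  fixes \<Sigma> :: "'a set"
  assumes sub: "\<Sigma> \<subseteq> Ar C"
begin

lemmas zpath_Ob' = zpath_Ob[OF category_axioms sub]

lemma zigzag_category: "category (zigzag C \<Sigma>)"
proof
  fix p assume "p \<in> Ar (zigzag C \<Sigma>)"
  then show "Dom (zigzag C \<Sigma>) p \<in> Ob (zigzag C \<Sigma>)" "Cod (zigzag C \<Sigma>) p \<in> Ob (zigzag C \<Sigma>)"
    using zpath_Ob' by (auto simp: zigzag_def)
qed (auto simp: zigzag_hom intro: zpath_append,
      auto simp: zigzag_def intro: zpath_append)

sublocale Z: quotient_cat "zigzag C \<Sigma>" "zz_rel C \<Sigma>"
  using zigzag_category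
  by (auto simp: quotient_cat_def quotient_cat_axioms_def precongruence_def zz_rel_def)

theorem loc_category: "category (loc C \<Sigma>)"
  using Z.quot_category by (simp add: loc_def)

abbreviation zq :: "'o \<times> 'a step list \<times> 'o \<Rightarrow> ('o \<times> 'a step list \<times> 'o) set" where
  "zq \<equiv> qcls (zigzag C \<Sigma>) (zz_rel C \<Sigma>)"

lemma fwd_hom: "f \<in> hom C A B \<Longrightarrow> (A, [Fwd f], B) \<in> hom (zigzag C \<Sigma>) A B"
  using hom_Ob[of f A B] homD[of f C A B] by (simp add: zigzag_hom)

lemma bwd_hom: "s \<in> \<Sigma> \<Longrightarrow> s \<in> hom C A B \<Longrightarrow> (B, [Bwd s], A) \<in> hom (zigzag C \<Sigma>) B A"
  using hom_Ob[of s A B] homD[of s C A B] by (simp add: zigzag_hom)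

lemma Comp_zigzag: "Comp (zigzag C \<Sigma>) (B', v, D) (A, w, B) = (A, w @ v, D)"
  and Id_zigzag: "Id (zigzag C \<Sigma>) A = (A, [], A)"
  by (simp_all add: zigzag_def)

lemma loc_fun_Ar: "f \<in> hom C A B \<Longrightarrow> onAr (loc_fun C \<Sigma>) f = zq (A, [Fwd f], B)"
  using Z.quot_fun_Ar[OF fwd_hom] homD[of f C A B] by (simp add: loc_fun_def)

lemma loc_fun_Ob: "A \<in> Ob C \<Longrightarrow> onOb (loc_fun C \<Sigma>) A = A"
  by (simp add: loc_fun_def)

lemma zq_eq:
  assumes "(p, q) \<in> zz_gen C \<Sigma>" "p \<in> hom (zigzag C \<Sigma>) A B" "q \<in> hom (zigzag C \<Sigma>) A B"
  shows "zq p = zq q"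
proof -
  have "(p, q) \<in> zz_rel C \<Sigma> A B" using assms by (simp add: zz_rel_def)
  then have "(p, q) \<in> cong_cl (zigzag C \<Sigma>) (zz_rel C \<Sigma>) A B" using cong_cl_upper[of "zz_rel C \<Sigma>" A B "zigzag C \<Sigma>"] by blast
  then show ?thesis using Z.qcls_eq_iff[OF assms(2,3)] by simp
qed

lemma nil_hom: "A \<in> Ob C \<Longrightarrow> (A, [], A) \<in> hom (zigzag C \<Sigma>) A A"
  by (simp add: zigzag_hom)

theorem loc_fun_functor: "cat_functor C (loc C \<Sigma>) (loc_fun C \<Sigma>)"
proof (intro cat_functor.intro cat_functor_axioms.intro category_axioms loc_category)
  show "onOb (loc_fun C \<Sigma>) \<in> Ob C \<rightarrow>\<^sub>E Ob (loc C \<Sigma>)"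
    by (auto simp: loc_fun_def loc_def quot_def zigzag_def)
  show "onAr (loc_fun C \<Sigma>) \<in> extensional (Ar C)" by (simp add: loc_fun_def)
next
  fix f A B assume f: "f \<in> hom C A B"
  then show "onAr (loc_fun C \<Sigma>) f \<in> hom (loc C \<Sigma>) (onOb (loc_fun C \<Sigma>) A) (onOb (loc_fun C \<Sigma>) B)"
    using hom_Ob[OF f] Z.qcls_hom[OF fwd_hom[OF f]]
    by (simp add: loc_fun_Ar[OF f] loc_fun_Ob loc_def)
next
  fix A assume A: "A \<in> Ob C"
  have "zq (A, [Fwd (Id C A)], A) = zq (A, [], A)"
    by (rule zq_eq[OF zz_Id[OF A] fwd_hom[OF Id_hom[OF A]] nil_hom[OF A]])
  then show "onAr (loc_fun C \<Sigma>) (Id C A) = Id (loc C \<Sigma>) (onOb (loc_fun C \<Sigma>) A)"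
    using A by (simp add: loc_fun_Ar[OF Id_hom[OF A]] loc_fun_Ob loc_def Z.Id_quot Id_zigzag)
next
  fix f A B g E assume f: "f \<in> hom C A B" and g: "g \<in> hom C B E"
  have "Comp (zigzag C \<Sigma>) (B, [Fwd g], E) (A, [Fwd f], B) \<in> hom (zigzag C \<Sigma>) A E"
    by (rule Z.Comp_hom[OF fwd_hom[OF f] fwd_hom[OF g]])
  then have "zq (A, [Fwd f, Fwd g], E) = zq (A, [Fwd (Comp C g f)], E)"
    by (intro zq_eq[OF zz_Comp[OF f g] _ fwd_hom[OF Comp_hom[OF f g]]])
       (simp add: Comp_zigzag)
  then show "onAr (loc_fun C \<Sigma>) (Comp C g f)
      = Comp (loc C \<Sigma>) (onAr (loc_fun C \<Sigma>) g) (onAr (loc_fun C \<Sigma>) f)"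
    using Z.Comp_quot[OF fwd_hom[OF f] fwd_hom[OF g]]
    by (simp add: loc_fun_Ar[OF f] loc_fun_Ar[OF g] loc_fun_Ar[OF Comp_hom[OF f g]]
        loc_def Comp_zigzag)
qed

lemma zq_inverse:
  assumes s: "s \<in> \<Sigma>" and h: "s \<in> hom C A B"
  shows "Comp (loc C \<Sigma>) (zq (B, [Bwd s], A)) (zq (A, [Fwd s], B)) = zq (A, [], A)"
    and "Comp (loc C \<Sigma>) (zq (A, [Fwd s], B)) (zq (B, [Bwd s], A)) = zq (B, [], B)"
proof -
  note f = fwd_hom[OF h] and b = bwd_hom[OF s h]
  have Ob: "A \<in> Ob C" "B \<in> Ob C" using hom_Ob[OF h] by auto
  have "zq (A, [Fwd s, Bwd s], A) = zq (A, [], A)"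
    using zq_eq[OF zz_inv_left[OF s h] _ nil_hom[OF Ob(1)]] Z.Comp_hom[OF f b]
    by (simp add: Comp_zigzag)
  then show "Comp (loc C \<Sigma>) (zq (B, [Bwd s], A)) (zq (A, [Fwd s], B)) = zq (A, [], A)"
    using Z.Comp_quot[OF f b] by (simp add: loc_def Comp_zigzag)
  have "zq (B, [Bwd s, Fwd s], B) = zq (B, [], B)"
    using zq_eq[OF zz_inv_right[OF s h] _ nil_hom[OF Ob(2)]] Z.Comp_hom[OF b f]
    by (simp add: Comp_zigzag)
  then show "Comp (loc C \<Sigma>) (zq (A, [Fwd s], B)) (zq (B, [Bwd s], A)) = zq (B, [], B)"
    using Z.Comp_quot[OF b f] by (simp add: loc_def Comp_zigzag)
qed

lemma Id_loc: "Id (loc C \<Sigma>) A = zq (A, [], A)"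
  by (simp add: loc_def Z.Id_quot Id_zigzag)

theorem loc_fun_inverts:
  assumes "s \<in> \<Sigma>"
  shows "iso_arr (loc C \<Sigma>) (onAr (loc_fun C \<Sigma>) s)"
proof -
  have h: "s \<in> hom C (Dom C s) (Cod C s)" using assms sub by (auto simp: hom_def)
  note f = homD[OF Z.qcls_hom[OF fwd_hom[OF h], folded loc_def]]
    and b = Z.qcls_hom[OF bwd_hom[OF assms h], folded loc_def]
  show ?thesis
    unfolding iso_arr_def loc_fun_Ar[OF h] Id_loc
    using f b zq_inverse[OF assms h] by auto
qed

context
  fixes D :: "('p, 'b) cat" and F :: "('o, 'a, 'p, 'b) func"
  assumes F: "cat_functor C D F" and inv: "\<And>s. s \<in> \<Sigma> \<Longrightarrow> iso_arr D (onAr F s)"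
begin

interpretation F: cat_functor C D F by (rule F)

definition sinv :: "'a \<Rightarrow> 'b" where
  "sinv s = (SOME g. g \<in> hom D (onOb F (Cod C s)) (onOb F (Dom C s))
     \<and> Comp D g (onAr F s) = Id D (onOb F (Dom C s))
     \<and> Comp D (onAr F s) g = Id D (onOb F (Cod C s)))"

lemma sinv:
  assumes "s \<in> \<Sigma>" "s \<in> hom C A B"
  shows "sinv s \<in> hom D (onOb F B) (onOb F A)"
    and "Comp D (sinv s) (onAr F s) = Id D (onOb F A)"
    and "Comp D (onAr F s) (sinv s) = Id D (onOb F B)"
proof -
  have "\<exists>g. g \<in> hom D (onOb F (Cod C s)) (onOb F (Dom C s))
     \<and> Comp D g (onAr F s) = Id D (onOb F (Dom C s))
     \<and> Comp D (onAr F s) g = Id D (onOb F (Cod C s))"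
    using inv[OF assms(1)] homD[OF F.onAr_hom[OF assms(2)]] homD[OF assms(2)]
    by (auto simp: iso_arr_def)
  from someI_ex[OF this]
  show "sinv s \<in> hom D (onOb F B) (onOb F A)"
    "Comp D (sinv s) (onAr F s) = Id D (onOb F A)"
    "Comp D (onAr F s) (sinv s) = Id D (onOb F B)"
    using homD[OF assms(2)] by (simp_all add: sinv_def)
qed

fun wev :: "'o \<Rightarrow> 'a step list \<Rightarrow> 'b" where
  "wev A [] = Id D (onOb F A)"
| "wev A (Fwd f # w) = Comp D (wev (Cod C f) w) (onAr F f)"
| "wev A (Bwd s # w) = Comp D (wev (Dom C s) w) (sinv s)"

lemma wev_hom: "zpath C \<Sigma> A w B \<Longrightarrow> wev A w \<in> hom D (onOb F A) (onOb F B)"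
proof (induction A w rule: wev.induct)
  case (1 A)
  then show ?case using F.target.Id_hom F.onOb_in by auto
next
  case (2 A f w)
  then have "f \<in> hom C A (Cod C f)" by (simp add: hom_def)
  from F.onAr_hom[OF this] show ?case using 2 F.target.Comp_hom by auto
next
  case (3 A s w)
  then have "s \<in> hom C (Dom C s) A" "s \<in> \<Sigma>" using sub by (auto simp: hom_def)
  from sinv(1)[OF this(2) this(1)] show ?case using 3 F.target.Comp_hom by auto
qed

lemma wev_append:
  assumes v: "zpath C \<Sigma> B v E"
  shows "zpath C \<Sigma> A w B \<Longrightarrow> wev A (w @ v) = Comp D (wev B v) (wev A w)"
proof (induction A w rule: wev.induct)
  case (1 A)
  then show ?case using wev_hom[OF v] F.target.Id_right by auto
next
  case (2 A f w)
  then have "f \<in> hom C A (Cod C f)" by (simp add: hom_def)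
  from F.onAr_hom[OF this] show ?case
    using 2 F.target.Comp_assoc[OF _ wev_hom wev_hom[OF v]] by auto
next
  case (3 A s w)
  then have "s \<in> hom C (Dom C s) A" "s \<in> \<Sigma>" using sub by (auto simp: hom_def)
  from sinv(1)[OF this(2) this(1)] show ?case
    using 3 F.target.Comp_assoc[OF _ wev_hom wev_hom[OF v]] by auto
qed

definition wfun :: "('o, 'o \<times> 'a step list \<times> 'o, 'p, 'b) func" where
  "wfun = \<lparr>onOb = onOb F, onAr = (\<lambda>(A, w, B) \<in> Ar (zigzag C \<Sigma>). wev A w)\<rparr>"

lemma wfun_Ar: "zpath C \<Sigma> A w B \<Longrightarrow> onAr wfun (A, w, B) = wev A w"
  by (simp add: wfun_def zigzag_def)

lemma wfun_functor: "cat_functor (zigzag C \<Sigma>) D wfun"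
proof (intro cat_functor.intro cat_functor_axioms.intro zigzag_category F.target.category_axioms)
  show "onOb wfun \<in> Ob (zigzag C \<Sigma>) \<rightarrow>\<^sub>E Ob D"
    using F.onOb_type by (simp add: wfun_def zigzag_def)
  show "onAr wfun \<in> extensional (Ar (zigzag C \<Sigma>))"
    by (simp add: wfun_def)
next
  fix p A B assume "p \<in> hom (zigzag C \<Sigma>) A B"
  then show "onAr wfun p \<in> hom D (onOb wfun A) (onOb wfun B)"
    using wev_hom wfun_Ar by (auto simp: zigzag_hom) (simp add: wfun_def)
next
  fix A assume "A \<in> Ob (zigzag C \<Sigma>)"
  then have "A \<in> Ob C" by (simp add: zigzag_def)
  then show "onAr wfun (Id (zigzag C \<Sigma>) A) = Id D (onOb wfun A)"
    using wfun_Ar[of A "[]" A] by (simp add: Id_zigzag) (simp add: wfun_def)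
next
  fix p A B q E assume "p \<in> hom (zigzag C \<Sigma>) A B" "q \<in> hom (zigzag C \<Sigma>) B E"
  then show "onAr wfun (Comp (zigzag C \<Sigma>) q p) = Comp D (onAr wfun q) (onAr wfun p)"
    by (auto simp: zigzag_hom Comp_zigzag wfun_Ar zpath_append wev_append)
qed

lemma wfun_fwd: "f \<in> hom C A B \<Longrightarrow> onAr wfun (A, [Fwd f], B) = onAr F f"
  using fwd_hom[of f A B] wfun_Ar[of A "[Fwd f]" B] F.onAr_hom[of f A B]
    F.target.Id_left[of "onAr F f" "onOb F A" "onOb F B"] homD[of f C A B]
  by (simp add: zigzag_hom)

lemma wfun_rel:
  assumes "(p, q) \<in> zz_rel C \<Sigma> A B"
  shows "onAr wfun p = onAr wfun q"
proof -
  interpret W: cat_functor "zigzag C \<Sigma>" D wfun by (rule wfun_functor)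
  have nil: "onAr wfun (A, [], A) = Id D (onOb F A)" if "A \<in> Ob C" for A
    using that by (simp add: wfun_Ar)
  have bwd: "onAr wfun (B, [Bwd s], A) = sinv s" if "s \<in> \<Sigma>" "s \<in> hom C A B" for s A B
    using that bwd_hom[OF that] wfun_Ar[of B "[Bwd s]" A] sinv(1)[OF that]
      F.target.Id_left[of "sinv s" "onOb F B" "onOb F A"] homD[of s C A B]
    by (simp add: zigzag_hom)
  have Id: "onAr wfun (A, [Fwd (Id C A)], A) = onAr wfun (A, [], A)" if "A \<in> Ob C" for A
    using that nil F.onAr_Id wfun_fwd[OF Id_hom] by simp
  have Comp: "onAr wfun (A, [Fwd f, Fwd g], E) = onAr wfun (A, [Fwd (Comp C g f)], E)"
    if f: "f \<in> hom C A B" and g: "g \<in> hom C B E" for f g A B E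
    using W.onAr_Comp[OF fwd_hom[OF f] fwd_hom[OF g]] wfun_fwd[OF f] wfun_fwd[OF g]
      F.onAr_Comp[OF f g] wfun_fwd[OF Comp_hom[OF f g]]
    by (simp add: Comp_zigzag)
  have "onAr wfun (A, [Fwd s, Bwd s], A) = onAr wfun (A, [], A)"
    "onAr wfun (B, [Bwd s, Fwd s], B) = onAr wfun (B, [], B)"
    if s: "s \<in> \<Sigma>" and h: "s \<in> hom C A B" for s A B
    using W.onAr_Comp[OF fwd_hom[OF h] bwd_hom[OF s h]] W.onAr_Comp[OF bwd_hom[OF s h] fwd_hom[OF h]]
      wfun_fwd[OF h] bwd[OF s h] sinv[OF s h] nil hom_Ob[OF h]
    by (simp_all add: Comp_zigzag)
  moreover have "(p, q) \<in> zz_gen C \<Sigma>" using assms by (simp add: zz_rel_def)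
  ultimately show ?thesis using Id Comp by (cases p, cases q) (auto elim!: zz_gen.cases)
qed

lemma loc_factor_exists: "\<exists>G. cat_functor (loc C \<Sigma>) D G \<and> func_comp C G (loc_fun C \<Sigma>) = F"
proof -
  obtain G where G: "cat_functor (loc C \<Sigma>) D G"
    and GQ: "func_comp (zigzag C \<Sigma>) G (quot_fun (zigzag C \<Sigma>) (zz_rel C \<Sigma>)) = wfun"
    using ex1_implies_ex[OF Z.quot_universal[OF wfun_functor]] wfun_rel unfolding loc_def by metis
  have "func_comp C G (loc_fun C \<Sigma>) = F"
  proof (rule func_eqI[OF func_comp_functor[OF loc_fun_functor G] F])
    fix A assume A: "A \<in> Ob C"
    have "onOb (func_comp (zigzag C \<Sigma>) G (quot_fun (zigzag C \<Sigma>) (zz_rel C \<Sigma>))) A = onOb wfun A"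
      using GQ by simp
    then show "onOb (func_comp C G (loc_fun C \<Sigma>)) A = onOb F A"
      using A by (simp add: func_comp_def compose_def loc_fun_Ob quot_fun_def wfun_def zigzag_def)
  next
    fix f assume f: "f \<in> Ar C"
    then have h: "f \<in> hom C (Dom C f) (Cod C f)" by (simp add: hom_def)
    let ?p = "(Dom C f, [Fwd f], Cod C f)"
    have "onAr (func_comp (zigzag C \<Sigma>) G (quot_fun (zigzag C \<Sigma>) (zz_rel C \<Sigma>))) ?p = onAr wfun ?p"
      using GQ by simp
    then show "onAr (func_comp C G (loc_fun C \<Sigma>)) f = onAr F f"
      using f homD[OF fwd_hom[OF h]]
      by (simp add: func_comp_def compose_def loc_fun_Ar[OF h] wfun_fwd[OF h]
          Z.quot_fun_Ar[OF fwd_hom[OF h]])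
  qed
  with G show ?thesis by blast
qed

end

lemma loc_factor_unique:
  assumes G: "cat_functor (loc C \<Sigma>) D G" and H: "cat_functor (loc C \<Sigma>) D H"
    and e: "func_comp C G (loc_fun C \<Sigma>) = func_comp C H (loc_fun C \<Sigma>)"
  shows "G = H"
proof -
  interpret G: cat_functor "loc C \<Sigma>" D G by (rule G)
  interpret H: cat_functor "loc C \<Sigma>" D H by (rule H)
  have ObL: "Ob (loc C \<Sigma>) = Ob C" by (simp add: loc_def quot_def zigzag_def)
  have Ob: "onOb G A = onOb H A" if "A \<in> Ob C" for A
  proof -
    have "onOb (func_comp C G (loc_fun C \<Sigma>)) A = onOb (func_comp C H (loc_fun C \<Sigma>)) A"
      using e by simp
    then show ?thesis using that by (simp add: func_comp_def compose_def loc_fun_Ob)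
  qed
  have fwd: "onAr G (zq (A, [Fwd f], B)) = onAr H (zq (A, [Fwd f], B))" if "f \<in> hom C A B" for f A B
  proof -
    have "onAr (func_comp C G (loc_fun C \<Sigma>)) f = onAr (func_comp C H (loc_fun C \<Sigma>)) f"
      using e by simp
    then show ?thesis using homD[OF that]
      by (simp add: func_comp_def compose_def loc_fun_Ar[OF that])
  qed
  have bwd: "onAr G (zq (B, [Bwd s], A)) = onAr H (zq (B, [Bwd s], A))"
    if s: "s \<in> \<Sigma>" and h: "s \<in> hom C A B" for s A B
  proof (rule is_inverse_unique[OF G.target.category_axioms])
    note f = Z.qcls_hom[OF fwd_hom[OF h], folded loc_def]
      and b = Z.qcls_hom[OF bwd_hom[OF s h], folded loc_def]
    have AB: "A \<in> Ob C" "B \<in> Ob C" using hom_Ob[OF h] by auto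
    show "onAr G (zq (A, [Fwd s], B)) \<in> hom D (onOb G A) (onOb G B)"
      "onAr G (zq (B, [Bwd s], A)) \<in> hom D (onOb G B) (onOb G A)"
      using G.onAr_hom f b by blast+
    show "onAr H (zq (B, [Bwd s], A)) \<in> hom D (onOb G B) (onOb G A)"
      using H.onAr_hom[OF b] Ob AB by simp
    show "Comp D (onAr G (zq (B, [Bwd s], A))) (onAr G (zq (A, [Fwd s], B))) = Id D (onOb G A)"
      using G.onAr_Comp[OF f b] zq_inverse(1)[OF s h] G.onAr_Id[of A] AB by (simp add: Id_loc ObL)
    show "Comp D (onAr G (zq (A, [Fwd s], B))) (onAr H (zq (B, [Bwd s], A))) = Id D (onOb G B)"
      using H.onAr_Comp[OF b f] zq_inverse(2)[OF s h] H.onAr_Id[of B] AB Ob fwd[OF h]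
      by (simp add: Id_loc ObL)
  qed
  have path: "onAr G (zq (A, w, B)) = onAr H (zq (A, w, B))" if "zpath C \<Sigma> A w B" for A w B
    using that
  proof (induction w arbitrary: A)
    case Nil
    then have "A \<in> Ob C" "A = B" by auto
    then show ?case using G.onAr_Id[of A] H.onAr_Id[of A] Ob by (simp add: Id_loc ObL)
  next
    case (Cons x w)
    have step: "onAr G (zq (A, x # w, B)) = onAr H (zq (A, x # w, B))"
      if x: "(A, [x], E) \<in> hom (zigzag C \<Sigma>) A E"
        "onAr G (zq (A, [x], E)) = onAr H (zq (A, [x], E))"
        and w: "zpath C \<Sigma> E w B" for E
    proof -
      have p: "(E, w, B) \<in> hom (zigzag C \<Sigma>) E B" using w by (simp add: zigzag_hom)
      have c: "zq (A, x # w, B) = Comp (loc C \<Sigma>) (zq (E, w, B)) (zq (A, [x], E))"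
        using Z.Comp_quot[OF x(1) p] by (simp add: loc_def Comp_zigzag)
      note q = Z.qcls_hom[OF x(1), folded loc_def] Z.qcls_hom[OF p, folded loc_def]
      show ?thesis
        using G.onAr_Comp[OF q] H.onAr_Comp[OF q] Cons.IH[OF w] x(2) c by simp
    qed
    show ?case
    proof (cases x)
      case (Fwd f)
      then have f: "f \<in> hom C A (Cod C f)" "zpath C \<Sigma> (Cod C f) w B"
        using Cons.prems by (auto simp: hom_def)
      show ?thesis using step[of "Cod C f"] fwd_hom[OF f(1)] fwd[OF f(1)] f(2) Fwd by simp
    next
      case (Bwd s)
      then have s: "s \<in> \<Sigma>" "s \<in> hom C (Dom C s) A" "zpath C \<Sigma> (Dom C s) w B"
        using Cons.prems sub by (auto simp: hom_def)
      show ?thesis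
        using step[of "Dom C s"] bwd_hom[OF s(1,2)] bwd[OF s(1,2)] s(3) Bwd by simp
    qed
  qed
  show ?thesis
  proof (rule func_eqI[OF G H])
    show "onOb G A = onOb H A" if "A \<in> Ob (loc C \<Sigma>)" for A using that Ob by (simp add: ObL)
  next
    fix X assume "X \<in> Ar (loc C \<Sigma>)"
    then obtain A B p where "p \<in> hom (zigzag C \<Sigma>) A B" "X = zq p"
      unfolding loc_def by (elim Z.quot_ArE)
    then show "onAr G X = onAr H X" using path by (auto simp: zigzag_hom)
  qed
qed

theorem loc_universal:
  fixes D :: "('p, 'b) cat"
  assumes "cat_functor C D F" "\<And>s. s \<in> \<Sigma> \<Longrightarrow> iso_arr D (onAr F s)"
  shows "\<exists>!G. cat_functor (loc C \<Sigma>) D G \<and> func_comp C G (loc_fun C \<Sigma>) = F"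
  using loc_factor_exists[OF assms] loc_factor_unique by blast

theorem rho_congruence: "congruence C (rho C \<Sigma>)"
proof -
  interpret Q: quotient_cat C "\<lambda>_ _. {}"
    by unfold_locales (simp add: precongruence_def)
  show ?thesis using Q.kernel_congruence[OF loc_fun_functor] by (simp add: rho_def[abs_def])
qed

theorem induced_fun_ex1:
  "\<exists>!I. cat_functor (quot C (rho C \<Sigma>)) (loc C \<Sigma>) I
     \<and> func_comp C I (quot_fun C (rho C \<Sigma>)) = loc_fun C \<Sigma>"
proof -
  interpret Q: quotient_cat C "rho C \<Sigma>"
    using rho_congruence by unfold_locales (simp add: congruence_def)
  show ?thesis by (rule Q.quot_universal[OF loc_fun_functor]) (simp add: rho_def)
qed

end

end

theory Submission
  imports Defs
begin

text \<open>Write \<open>P\<close> for the localization functor, \<open>Q\<close> for the quotient functor by \<open>rho C \<Sigma>\<close>, and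
  \<open>I\<close> for the induced functor, so that \<open>I \<circ> Q = P\<close>.

  Both \<open>P\<close> and \<open>Q\<close> are universal: \<open>P\<close> among functors inverting \<open>\<Sigma>\<close>, \<open>Q\<close> among functors
  that identify the arrows which \<open>P\<close> identifies. Hence they agree as soon as \<open>Q\<close> inverts
  \<open>\<Sigma>\<close>, and that is exactly what \<open>\<Sigma> \<subseteq> sigma C (rho C \<Sigma>)\<close> says. In that case \<open>Q\<close> factors through \<open>P\<close>, say \<open>Q = G \<circ> P\<close>.
  Then \<open>I \<circ> G\<close> fixes \<open>P\<close> and \<open>G \<circ> I\<close> fixes \<open>Q\<close>, so both are identities
  (\<open>strict_epi_locI\<close>). Conversely, suppose that \<open>P\<close> is isomorphic under \<open>C\<close> to a quotient by some
  congruence \<open>R\<close>. Functors that factor through each other identify the same arrows, so \<open>R\<close> is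
  forced to be the kernel of \<open>P\<close>, that is, \<open>rho C \<Sigma>\<close> (\<open>iso_under_loc_imp_eq_rho\<close>); and the
  quotient functor inverts \<open>\<Sigma>\<close>, being \<open>P\<close> followed by an isomorphism. The remaining
  implication takes \<open>R\<close> to be \<open>rho C \<Sigma>\<close> and \<open>I\<close> as the isomorphism.\<close>

lemma onOb_func_comp: "A \<in> Ob C \<Longrightarrow> onOb (func_comp C G F) A = onOb G (onOb F A)"
  and onAr_func_comp: "f \<in> Ar C \<Longrightarrow> onAr (func_comp C G F) f = onAr G (onAr F f)"
  by (simp_all add: func_comp_def compose_def)

lemma func_id_functor:
  assumes "category C"
  shows "cat_functor C C (func_id C)"
proof -
  interpret category C by fact
  show ?thesis
  proof
    show "onOb (func_id C) \<in> Ob C \<rightarrow>\<^sub>E Ob C" "onAr (func_id C) \<in> extensional (Ar C)"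
      by (auto simp: func_id_def)
  next
    fix f A B assume f: "f \<in> hom C A B"
    then show "onAr (func_id C) f \<in> hom C (onOb (func_id C) A) (onOb (func_id C) B)"
      using hom_Ob[OF f] homD[OF f] by (simp add: func_id_def)
  next
    fix A assume A: "A \<in> Ob C"
    then show "onAr (func_id C) (Id C A) = Id C (onOb (func_id C) A)"
      using homD[OF Id_hom[OF A]] by (simp add: func_id_def)
  next
    fix f A B g E assume f: "f \<in> hom C A B" and g: "g \<in> hom C B E"
    then show "onAr (func_id C) (Comp C g f) = Comp C (onAr (func_id C) g) (onAr (func_id C) f)"
      using homD[OF f] homD[OF g] homD[OF Comp_hom[OF f g]] by (simp add: func_id_def)
  qed
qed

lemma (in cat_functor) onAr_in: "f \<in> Ar C \<Longrightarrow> onAr F f \<in> Ar D"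
  using onAr_hom homI homD by metis

lemma func_comp_id_left:
  assumes "cat_functor C D F"
  shows "func_comp C (func_id D) F = F"
proof -
  interpret F: cat_functor C D F by fact
  show ?thesis
    by (rule func_eqI[OF func_comp_functor[OF assms
            func_id_functor[OF F.target.category_axioms]] assms])
      (auto simp: onOb_func_comp onAr_func_comp func_id_def F.onOb_in F.onAr_in)
qed

lemma func_comp_assoc:
  assumes "cat_functor C D F" "cat_functor D E G" "cat_functor E B H"
  shows "func_comp C H (func_comp C G F) = func_comp C (func_comp D H G) F"
proof -
  interpret F: cat_functor C D F by fact
  show ?thesis
    by (rule func_eqI[OF func_comp_functor[OF func_comp_functor[OF assms(1,2)] assms(3)]
            func_comp_functor[OF assms(1) func_comp_functor[OF assms(2,3)]]])
      (auto simp: onOb_func_comp onAr_func_comp F.onOb_in F.onAr_in)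
qed

lemma cat_iso_factorization:
  assumes F: "cat_functor C D F" and "cat_iso D E H" and G: "func_comp C H F = G"
  obtains K where "cat_functor E D K" "func_comp C K G = F"
proof -
  obtain K where H: "cat_functor D E H" and K: "cat_functor E D K"
    and KH: "func_comp D K H = func_id D"
    using assms(2) unfolding cat_iso_def by blast
  have "func_comp C K G = F"
    using func_comp_assoc[OF F H K] KH func_comp_id_left[OF F] G by simp
  with K show thesis by (rule that)
qed

lemma (in quotient_cat) quot_endofunctor_unique:
  assumes "cat_functor (quot C R) (quot C R) G" "func_comp C G (quot_fun C R) = quot_fun C R"
  shows "G = func_id (quot C R)"
proof -
  have "onAr (quot_fun C R) f = onAr (quot_fun C R) g" if fg: "(f, g) \<in> R A B" for A B f g
  proof -
    have "f \<in> hom C A B" "g \<in> hom C A B"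
      using precong fg unfolding precongruence_def by blast+
    moreover have "(f, g) \<in> cong_cl C R A B" using fg cong_cl_upper[of R A B C] by blast
    ultimately show ?thesis using qcls_eq_iff by (simp add: quot_fun_Ar)
  qed
  then have "\<exists>!G. cat_functor (quot C R) (quot C R) G \<and> func_comp C G (quot_fun C R) = quot_fun C R"
    by (rule quot_universal[OF quot_fun_functor])
  moreover have "func_comp C (func_id (quot C R)) (quot_fun C R) = quot_fun C R"
    by (rule func_comp_id_left[OF quot_fun_functor])
  ultimately show ?thesis
    using assms func_id_functor[OF quot_category] by (elim ex1E) metis
qed

lemma (in localized_cat) loc_endofunctor_unique:
  assumes "cat_functor (loc C \<Sigma>) (loc C \<Sigma>) G" "func_comp C G (loc_fun C \<Sigma>) = loc_fun C \<Sigma>"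
  shows "G = func_id (loc C \<Sigma>)"
  by (rule loc_factor_unique[OF assms(1) func_id_functor[OF loc_category]])
    (simp add: assms(2) func_comp_id_left[OF loc_fun_functor])

context localized_cat
begin

interpretation rho: quotient_cat C "rho C \<Sigma>"
  using rho_congruence by unfold_locales (simp add: congruence_def)

lemma induced_fun:
  "cat_functor (quot C (rho C \<Sigma>)) (loc C \<Sigma>) (induced_fun C \<Sigma>)"
  "func_comp C (induced_fun C \<Sigma>) (quot_fun C (rho C \<Sigma>)) = loc_fun C \<Sigma>"
  using theI'[OF induced_fun_ex1] unfolding induced_fun_def by blast+

text \<open>The hypothesis says that the quotient functor inverts \<open>\<Sigma>\<close>, so it factors through the
  localization; this factor is the inverse of the comparison functor, since both composites are
  endofunctors under \<open>C\<close>.\<close>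

lemma strict_epi_locI:
  assumes "\<Sigma> \<subseteq> sigma C (rho C \<Sigma>)"
  shows "strict_epi_loc C \<Sigma>"
proof -
  let ?Q = "quot C (rho C \<Sigma>)" and ?q = "quot_fun C (rho C \<Sigma>)"
    and ?L = "loc C \<Sigma>" and ?p = "loc_fun C \<Sigma>" and ?I = "induced_fun C \<Sigma>"
  have "iso_arr ?Q (onAr ?q s)" if "s \<in> \<Sigma>" for s
    using assms that by (auto simp: sigma_def)
  then obtain G where G: "cat_functor ?L ?Q G" and Gp: "func_comp C G ?p = ?q"
    using loc_factor_exists[OF rho.quot_fun_functor] by blast
  have "func_comp C (func_comp ?Q G ?I) ?q = ?q"
    using func_comp_assoc[OF rho.quot_fun_functor induced_fun(1) G] by (simp add: induced_fun(2) Gp)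
  then have "func_comp ?Q G ?I = func_id ?Q"
    by (rule rho.quot_endofunctor_unique[OF func_comp_functor[OF induced_fun(1) G]])
  moreover have "func_comp C (func_comp ?L ?I G) ?p = ?p"
    using func_comp_assoc[OF loc_fun_functor G induced_fun(1)] by (simp add: induced_fun(2) Gp)
  then have "func_comp ?L ?I G = func_id ?L"
    by (rule loc_endofunctor_unique[OF func_comp_functor[OF G induced_fun(1)]])
  ultimately show ?thesis
    unfolding strict_epi_loc_def cat_iso_def using induced_fun(1) G by blast
qed

text \<open>Each of two isomorphic functors under \<open>C\<close> factors through the other, so they identify the
  same parallel arrows: those related by \<open>R\<close> for the quotient functor, those related by
  \<open>rho C \<Sigma>\<close> for the localization.\<close>

lemma iso_under_loc_imp_eq_rho:
  assumes R: "congruence C R"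
    and iso: "iso_under C (quot C R) (quot_fun C R) (loc C \<Sigma>) (loc_fun C \<Sigma>)"
  shows "R = rho C \<Sigma>"
proof -
  interpret R: quotient_cat C R
    using R by unfold_locales (simp add: congruence_def)
  obtain H where H: "cat_iso (quot C R) (loc C \<Sigma>) H"
    and Hq: "func_comp C H (quot_fun C R) = loc_fun C \<Sigma>"
    using iso unfolding iso_under_def by blast
  obtain K where Kp: "func_comp C K (loc_fun C \<Sigma>) = quot_fun C R"
    using cat_iso_factorization[OF R.quot_fun_functor H Hq] by blast
  have ker: "(f, g) \<in> R A B \<longleftrightarrow> onAr (loc_fun C \<Sigma>) f = onAr (loc_fun C \<Sigma>) g"
    if f: "f \<in> hom C A B" and g: "g \<in> hom C A B" for f g A B
  proof -
    have "(f, g) \<in> R A B \<longleftrightarrow> onAr (quot_fun C R) f = onAr (quot_fun C R) g"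
      using R.qcls_eq_iff[OF f g] by (simp add: R.quot_fun_Ar[OF f] R.quot_fun_Ar[OF g]
          cong_cl_id[OF R])
    also have "\<dots> \<longleftrightarrow> onAr (loc_fun C \<Sigma>) f = onAr (loc_fun C \<Sigma>) g"
      using homD[OF f] homD[OF g] Hq Kp by (metis onAr_func_comp)
    finally show ?thesis .
  qed
  have R_hom: "R A B \<subseteq> hom C A B \<times> hom C A B" for A B
    using R unfolding congruence_def precongruence_def by blast
  have "(f, g) \<in> R A B \<longleftrightarrow> (f, g) \<in> rho C \<Sigma> A B" for f g A B
    using R_hom[of A B] ker[of f A B g] unfolding rho_def by blast
  then show ?thesis by (intro ext) auto
qed

text \<open>Functors preserve isomorphisms, so the quotient functor, which factors through the
  localization, inverts whatever the localization inverts.\<close>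

lemma iso_under_loc_imp_subset_sigma_rho:
  assumes R: "congruence C R"
    and iso: "iso_under C (quot C R) (quot_fun C R) (loc C \<Sigma>) (loc_fun C \<Sigma>)"
  shows "\<Sigma> \<subseteq> sigma C (rho C \<Sigma>)"
proof
  fix s assume s: "s \<in> \<Sigma>"
  obtain H where q: "cat_functor C (quot C R) (quot_fun C R)"
    and H: "cat_iso (quot C R) (loc C \<Sigma>) H"
    and Hq: "func_comp C H (quot_fun C R) = loc_fun C \<Sigma>"
    using iso unfolding iso_under_def by blast
  obtain K where K: "cat_functor (loc C \<Sigma>) (quot C R) K"
    and Kp: "func_comp C K (loc_fun C \<Sigma>) = quot_fun C R"
    by (rule cat_iso_factorization[OF q H Hq])
  have "s \<in> Ar C" using s sub by blast
  moreover have "onAr (quot_fun C R) s = onAr K (onAr (loc_fun C \<Sigma>) s)"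
    using onAr_func_comp[OF calculation] Kp by metis
  ultimately have "s \<in> sigma C R"
    using functor_iso_arr[OF K loc_fun_inverts[OF s]] by (simp add: sigma_def)
  then show "s \<in> sigma C (rho C \<Sigma>)"
    by (simp flip: iso_under_loc_imp_eq_rho[OF assms])
qed

lemma strict_epi_loc_imp_iso_under:
  assumes "strict_epi_loc C \<Sigma>"
  shows "iso_under C (quot C (rho C \<Sigma>)) (quot_fun C (rho C \<Sigma>)) (loc C \<Sigma>) (loc_fun C \<Sigma>)"
  using assms rho.quot_fun_functor loc_fun_functor induced_fun(2)
  unfolding iso_under_def strict_epi_loc_def by blast

end

theorem corollary3p1p10:
  fixes C :: "('o, 'a) cat" and \<Sigma> :: "'a set"
  assumes "category C" and "\<Sigma> \<subseteq> Ar C"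
  shows "((\<exists>R. congruence C R \<and>
              iso_under C (quot C R) (quot_fun C R) (loc C \<Sigma>) (loc_fun C \<Sigma>))
            \<longleftrightarrow> strict_epi_loc C \<Sigma>)
       \<and> (strict_epi_loc C \<Sigma> \<longleftrightarrow> \<Sigma> \<subseteq> sigma C (rho C \<Sigma>))"
proof -
  interpret localized_cat C \<Sigma>
    using assms by (simp add: localized_cat_def localized_cat_axioms_def)
  show ?thesis
    using strict_epi_locI iso_under_loc_imp_subset_sigma_rho
      strict_epi_loc_imp_iso_under rho_congruence
    by blast
qed

end
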